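(* Let $r$ be a non-negative integer and $n,k,\lambda$ positive integers with $r\le n\le k$. Let $\boldsymbol\rho=(\rho_1,\dots,\rho_k)$ be a $k$-tuple of integers with $1\le\rho_\ell\le\lambda n$ for each $\ell\in[k]$ and $\sum_{\ell\in[k]}\rho_\ell=\lambda n^2$. An $r\times n$ $(\boldsymbol\rho,\lambda)$-Latin rectangle $M$ can be extended to an $n\times n$ $(\boldsymbol\rho,\lambda)$-Latin square if and only if \begin{align*} &\rho_\ell-|M_\ell|\le\lambda(n-r) &&\text{for all }\ell\in[k],\\ &\sum_{j\in[n]}\Big((\lambda n-\lambda r+|{}^jM_K|)\,\dot{-}\,\lambda|K|\Big)\le\sum_{\ell\in\bar K}\big(\rho_\ell-|M_\ell|\big) &&\text{for all }K\subseteq[k]. \end{align*}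
   Context: Notation: $[m]=\{1,\dots,m\}$ (so $[0]=\varnothing$); $x\,\dot{-}\,y:=\max\{0,x-y\}$; for $K\subseteq[k]$, $\bar K=[k]\setminus K$. An $r\times s$ $\lambda$-matrix $M$ on the symbol set $[k]$ is an $r\times s$ array in which each cell contains a multiset of exactly $\lambda$ elements of $[k]$. For $\ell\in[k]$, $|M_\ell|$, $|M^i_\ell|$, $|{}^jM_\ell|$ denote the number of occurrences (with multiplicity) of $\ell$ in $M$, in row $i$ of $M$, and in column $j$ of $M$; for $K\subseteq[k]$, $|{}^jM_K|=\sum_{\ell\in K}|{}^jM_\ell|$. An $n\times n$ $(\boldsymbol\rho,\lambda)$-Latin square is an $n\times n$ $\lambda$-matrix $N$ on $[k]$ with $|N_\ell|=\rho_\ell$, $|N^i_\ell|\le\lambda$, $|{}^jN_\ell|\le\lambda$ for all $\ell\in[k]$, $i,j\in[n]$. An $r\times n$ $(\boldsymbol\rho,\lambda)$-Latin rectangle is an $r\times n$ $\lambda$-matrix $M$ on $[k]$ with $|M_\ell|\le\rho_\ell$, $|M^i_\ell|\le\lambda$, $|{}^jM_\ell|\le\lambda$ for all $\ell\in[k]$, $i\in[r]$, $j\in[n]$. $M$ is extended to $N$ if $M$ consists of the first $r$ rows of $N$. *)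

theory Defs
  imports Main "HOL-Library.Multiset"
begin

text \<open>
  Indices are 1-based, so \<open>[m]\<close> is \<open>{1..m}\<close>. An \<open>r \<times> s\<close> array of multisets is a function of the
  row and column index; only its values on \<open>{1..r} \<times> {1..s}\<close> matter, and every notion below
  looks only at those.
\<close>

type_synonym array = "nat \<Rightarrow> nat \<Rightarrow> nat multiset"

definition lambda_matrix :: "nat \<Rightarrow> nat \<Rightarrow> nat \<Rightarrow> nat \<Rightarrow> array \<Rightarrow> bool" where
  "lambda_matrix r s k lam M \<longleftrightarrow>
     (\<forall>i\<in>{1..r}. \<forall>j\<in>{1..s}. size (M i j) = lam \<and> set_mset (M i j) \<subseteq> {1..k})"

definition occ :: "nat \<Rightarrow> nat \<Rightarrow> array \<Rightarrow> nat \<Rightarrow> nat" where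
  "occ r s M l = (\<Sum>i\<in>{1..r}. \<Sum>j\<in>{1..s}. count (M i j) l)"

definition row_occ :: "nat \<Rightarrow> array \<Rightarrow> nat \<Rightarrow> nat \<Rightarrow> nat" where
  "row_occ s M i l = (\<Sum>j\<in>{1..s}. count (M i j) l)"

definition col_occ :: "nat \<Rightarrow> array \<Rightarrow> nat \<Rightarrow> nat \<Rightarrow> nat" where
  "col_occ r M j l = (\<Sum>i\<in>{1..r}. count (M i j) l)"

definition col_occ_set :: "nat \<Rightarrow> array \<Rightarrow> nat \<Rightarrow> nat set \<Rightarrow> nat" where
  "col_occ_set r M j K = (\<Sum>l\<in>K. col_occ r M j l)"

definition latin_square :: "nat \<Rightarrow> nat \<Rightarrow> (nat \<Rightarrow> int) \<Rightarrow> nat \<Rightarrow> array \<Rightarrow> bool" where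
  "latin_square n k \<rho> lam N \<longleftrightarrow>
     lambda_matrix n n k lam N \<and>
     (\<forall>l\<in>{1..k}. int (occ n n N l) = \<rho> l) \<and>
     (\<forall>l\<in>{1..k}. \<forall>i\<in>{1..n}. row_occ n N i l \<le> lam) \<and>
     (\<forall>l\<in>{1..k}. \<forall>j\<in>{1..n}. col_occ n N j l \<le> lam)"

definition latin_rectangle :: "nat \<Rightarrow> nat \<Rightarrow> nat \<Rightarrow> (nat \<Rightarrow> int) \<Rightarrow> nat \<Rightarrow> array \<Rightarrow> bool" where
  "latin_rectangle r n k \<rho> lam M \<longleftrightarrow>
     lambda_matrix r n k lam M \<and>
     (\<forall>l\<in>{1..k}. int (occ r n M l) \<le> \<rho> l) \<and>
     (\<forall>l\<in>{1..k}. \<forall>i\<in>{1..r}. row_occ n M i l \<le> lam) \<and>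
     (\<forall>l\<in>{1..k}. \<forall>j\<in>{1..n}. col_occ r M j l \<le> lam)"

definition extends_to :: "nat \<Rightarrow> nat \<Rightarrow> array \<Rightarrow> array \<Rightarrow> bool" where
  "extends_to r n M N \<longleftrightarrow> (\<forall>i\<in>{1..r}. \<forall>j\<in>{1..n}. N i j = M i j)"

definition monus :: "int \<Rightarrow> int \<Rightarrow> int" where
  "monus x y = max 0 (x - y)"

end

theory Submission
  imports Defs
begin

text \<open>
  Only column contents matter when a rectangle is extended: let \<open>x (j, l)\<close> be the number of
  copies of the symbol \<open>l\<close> that the missing \<open>m = n - r\<close> rows contribute to column \<open>j\<close>. In an
  extension, column \<open>j\<close> receives \<open>lam * m\<close> new symbols, the symbol \<open>l\<close> is used
  \<open>d l = \<rho> l - occ r n M l\<close> more times, and \<open>x (j, l) \<le> lam - col_occ r M j l\<close>. Conversely, any such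
  table \<open>x\<close> in which no \<open>d l\<close> exceeds \<open>lam * m\<close> can be distributed over the \<open>m\<close> new rows, so
  the theorem is about the existence of such a table.

  Whether the table exists is a transportation problem with supplies \<open>lam * m\<close>, demands \<open>d\<close> and
  edge capacities. Its solvability is governed by cuts (\<open>transportation\<close>): for every set
  \<open>J\<close> of columns and every set \<open>L\<close> of symbols, the supply of \<open>J\<close> must fit into the capacity of
  the edges from \<open>J\<close> to the symbols outside \<open>L\<close> plus the demand of \<open>L\<close>. With \<open>K\<close> the complement
  of \<open>L\<close>, a column \<open>j \<in> J\<close> adds \<open>lam * m + col_occ_set r M j K - lam * card K\<close> to what \<open>L\<close> must
  absorb. The worst \<open>J\<close> for given \<open>K\<close> consists of the columns where this is positive, and this is
  why the truncated difference appears.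

  Distributing \<open>x\<close> over the rows means splitting a bipartite multigraph, with degrees \<open>lam * m\<close> at
  the columns and at most \<open>lam * m\<close> at the symbols, into \<open>m\<close> parts with degrees \<open>lam\<close> and at
  most \<open>lam\<close>. Adding \<open>k - n\<close> dummy columns makes the multigraph regular
  (\<open>semiregular_splitting\<close>), and a regular one can be peeled: by the transportation
  criterion it contains a \<open>lam\<close>-regular part (\<open>regular_factor\<close>), whose removal leaves a
  regular multigraph of degree \<open>lam * (m - 1)\<close>.
\<close>

section \<open>Transportation with capacities\<close>

lemma sum_decrement:
  fixes f :: "'a \<Rightarrow> nat"
  assumes "finite S" "0 < f e"
  shows "sum (f(e := f e - 1)) S + of_bool (e \<in> S) = sum f S"
proof (cases "e \<in> S")
  case True
  have "sum (f(e := f e - 1)) (S - {e}) = sum f (S - {e})"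
    by (rule sum.cong) auto
  then show ?thesis
    using True assms sum.remove[of S e f] sum.remove[of S e "f(e := f e - 1)"] by simp
next
  case False
  then have "sum (f(e := f e - 1)) S = sum f S"
    by (intro sum.cong) auto
  then show ?thesis using False by simp
qed

definition cut_condition ::
    "'a set \<Rightarrow> 'b set \<Rightarrow> ('a \<times> 'b \<Rightarrow> nat) \<Rightarrow> ('a \<Rightarrow> nat) \<Rightarrow> ('b \<Rightarrow> nat) \<Rightarrow> bool" where
  "cut_condition A B b a d \<longleftrightarrow>
     (\<forall>J\<subseteq>A. \<forall>L\<subseteq>B. sum a J \<le> sum b (J \<times> (B - L)) + sum d L)"

text \<open>
  Uncrossing. The cut value is submodular in \<open>(J, L)\<close>, so union and intersection of two tight cuts
  leave no slack. But an edge from \<open>J - J'\<close> to \<open>L' - L\<close> is counted by the first cut and by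
  neither the union nor the intersection, so its capacity would be such slack.
\<close>

lemma no_crossing_tight_cuts:
  fixes b :: "'a \<times> 'b \<Rightarrow> nat" and a :: "'a \<Rightarrow> nat" and d :: "'b \<Rightarrow> nat"
  assumes fin: "finite A" "finite B"
    and cut: "cut_condition A B b a d"
    and sub: "J \<subseteq> A" "J' \<subseteq> A" "L \<subseteq> B" "L' \<subseteq> B"
    and tight: "sum a J = sum b (J \<times> (B - L)) + sum d L"
    and tight': "sum a J' = sum b (J' \<times> (B - L')) + sum d L'"
    and e: "j \<in> J - J'" "l \<in> L' - L"
  shows "b (j, l) = 0"
proof -
  have finJ: "finite J" "finite J'" "finite L" "finite L'"
    using fin sub finite_subset by metis+
  define S S' where "S = J \<times> (B - L)" and "S' = J' \<times> (B - L')"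
  define P Q where "P = (J \<union> J') \<times> (B - (L \<union> L'))" and "Q = (J \<inter> J') \<times> (B - (L \<inter> L'))"
  have finS: "finite S" "finite S'" "finite P" "finite Q"
    unfolding S_def S'_def P_def Q_def using finJ fin by auto
  have a_mod: "sum a (J \<union> J') + sum a (J \<inter> J') = sum a J + sum a J'"
    using finJ by (simp add: sum.union_inter)
  have d_mod: "sum d (L \<union> L') + sum d (L \<inter> L') = sum d L + sum d L'"
    using finJ by (simp add: sum.union_inter)
  have "sum a (J \<union> J') \<le> sum b P + sum d (L \<union> L')"
    "sum a (J \<inter> J') \<le> sum b Q + sum d (L \<inter> L')"
    using cut sub unfolding cut_condition_def P_def Q_def by (simp_all add: le_infI1)
  then have "sum b S + sum b S' \<le> sum b P + sum b Q"
    using a_mod d_mod tight tight' unfolding S_def S'_def by linarith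
  also have "\<dots> = sum b (P \<union> Q) + sum b (P \<inter> Q)"
    using finS by (simp add: sum.union_inter)
  also have "sum b (P \<inter> Q) \<le> sum b (S \<inter> S')"
    using finS by (intro sum_mono2) (auto simp: S_def S'_def P_def Q_def)
  finally have 1: "sum b S + sum b S' \<le> sum b (P \<union> Q) + sum b (S \<inter> S')" by simp
  have "b (j, l) + sum b (P \<union> Q) = sum b (insert (j, l) (P \<union> Q))"
    using finS e by (subst sum.insert) (auto simp: P_def Q_def)
  also have "\<dots> \<le> sum b (S \<union> S')"
    using finS e sub by (intro sum_mono2) (auto simp: S_def S'_def P_def Q_def)
  finally have "b (j, l) + sum b (P \<union> Q) + sum b (S \<inter> S') \<le> sum b S + sum b S'"
    using sum.union_inter[OF finS(1,2), of b] by linarith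
  with 1 show ?thesis by linarith
qed

text \<open>
  Induction on the total capacity. Take an edge \<open>(j, l)\<close> of positive capacity and either delete one
  unit of it, or route one unit of flow through it, which also lowers \<open>a j\<close> and \<open>d l\<close>. Deleting
  violates the cut condition only if a tight cut has \<open>j \<in> J\<close> and \<open>l \<notin> L\<close>, routing only if a tight
  cut has \<open>j \<notin> J\<close> and \<open>l \<in> L\<close>. Two such cuts cross at \<open>(j, l)\<close>, so one of the two moves is safe.
\<close>

lemma transportation_le:
  fixes b :: "'a \<times> 'b \<Rightarrow> nat" and a :: "'a \<Rightarrow> nat" and d :: "'b \<Rightarrow> nat"
  assumes fin: "finite A" "finite B" and "cut_condition A B b a d"
  shows "\<exists>x. (\<forall>p\<in>A \<times> B. x p \<le> b p) \<and> (\<forall>j\<in>A. (\<Sum>l\<in>B. x (j, l)) = a j) \<and>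
             (\<forall>l\<in>B. (\<Sum>j\<in>A. x (j, l)) \<le> d l)"
  using assms(3)
proof (induction "sum b (A \<times> B)" arbitrary: b a d rule: less_induct)
  case less
  note cut = less.prems
  have finAB: "finite (A \<times> B)" using fin by simp
  show ?case
  proof (cases "\<forall>p\<in>A \<times> B. b p = 0")
    case True
    have "a j = 0" if "j \<in> A" for j
    proof -
      have "sum a {j} \<le> sum b ({j} \<times> (B - {})) + sum d {}"
        using cut that unfolding cut_condition_def by blast
      moreover have "sum b ({j} \<times> (B - {})) = 0"
        using True that by (intro sum.neutral) auto
      ultimately show ?thesis by simp
    qed
    then show ?thesis by (intro exI[of _ "\<lambda>_. 0"]) auto
  next
    case False
    then obtain j l where jl: "j \<in> A" "l \<in> B" and pos: "0 < b (j, l)" by auto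
    define b' where "b' = b((j, l) := b (j, l) - 1)"
    have b'_le: "b' p \<le> b p" for p unfolding b'_def by simp
    have sum_b': "sum b' (J \<times> (B - L)) + of_bool (j \<in> J \<and> l \<notin> L) = sum b (J \<times> (B - L))"
      if "J \<subseteq> A" for J L
      using sum_decrement[of "J \<times> (B - L)" b "(j, l)"] pos fin that jl
      by (auto simp: b'_def finite_subset)
    have smaller: "sum b' (A \<times> B) < sum b (A \<times> B)"
      using sum_b'[of A "{}"] jl by simp
    show ?thesis
    proof (cases "cut_condition A B b' a d")
      case True
      from less.hyps[OF smaller True] obtain x where
        x: "\<forall>p\<in>A \<times> B. x p \<le> b' p" "\<forall>j\<in>A. (\<Sum>l\<in>B. x (j, l)) = a j"
           "\<forall>l\<in>B. (\<Sum>j\<in>A. x (j, l)) \<le> d l" by blast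
      then have "\<forall>p\<in>A \<times> B. x p \<le> b p" using b'_le order_trans by blast
      with x show ?thesis by blast
    next
      case False
      then obtain J L where JL: "J \<subseteq> A" "L \<subseteq> B"
        and viol: "\<not> sum a J \<le> sum b' (J \<times> (B - L)) + sum d L"
        unfolding cut_condition_def by blast
      have cutJL: "sum a J \<le> sum b (J \<times> (B - L)) + sum d L"
        using cut JL unfolding cut_condition_def by blast
      have jJ: "j \<in> J" "l \<notin> L"
        using viol cutJL sum_b'[OF JL(1), of L] by (auto split: if_splits simp: of_bool_def)
      have tight: "sum a J = sum b (J \<times> (B - L)) + sum d L"
        using viol cutJL sum_b'[OF JL(1), of L] jJ by simp
      \<comment> \<open>The tight cut \<open>(J, L)\<close> that forbids deletion excludes a tight cut that forbids routing.\<close>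
      have loose: "sum a J' < sum b (J' \<times> (B - L')) + sum d L'"
        if "J' \<subseteq> A" "L' \<subseteq> B" "j \<notin> J'" "l \<in> L'" for J' L'
      proof -
        have "sum a J' \<noteq> sum b (J' \<times> (B - L')) + sum d L'"
          using no_crossing_tight_cuts[OF fin cut JL(1) that(1) JL(2) that(2) tight, of j l] jJ that pos
          by auto
        moreover have "sum a J' \<le> sum b (J' \<times> (B - L')) + sum d L'"
          using cut that unfolding cut_condition_def by blast
        ultimately show ?thesis by linarith
      qed
      have dl: "0 < d l"
        using loose[of "{}" "{l}"] jl by simp
      \<comment> \<open>If \<open>a j\<close> were zero, removing \<open>j\<close> from the tight cut would lower its capacity but not its
        supply, against the cut condition.\<close>
      have aj: "0 < a j"
      proof -
        have "sum a (J - {j}) \<le> sum b ((J - {j}) \<times> (B - L)) + sum d L"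
          using cut JL unfolding cut_condition_def by blast
        moreover have "sum b ((J - {j}) \<times> (B - L)) + b (j, l) \<le> sum b (J \<times> (B - L))"
        proof -
          have "sum b (insert (j, l) ((J - {j}) \<times> (B - L))) \<le> sum b (J \<times> (B - L))"
            using JL jJ jl fin finite_subset[OF JL(1)] by (intro sum_mono2) auto
          then show ?thesis
            using fin finite_subset[OF JL(1)] by (subst (asm) sum.insert) auto
        qed
        moreover have "sum a J = a j + sum a (J - {j})"
          using jJ finite_subset[OF JL(1)] fin by (simp add: sum.remove)
        ultimately show ?thesis using tight pos by linarith
      qed
      define a' d' where "a' = a(j := a j - 1)" and "d' = d(l := d l - 1)"
      have "cut_condition A B b' a' d'"
        unfolding cut_condition_def
      proof (intro allI impI)
        fix J' L' assume sub: "J' \<subseteq> A" "L' \<subseteq> B"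
        have fin': "finite J'" "finite L'" using sub fin finite_subset by metis+
        have "sum a' J' + of_bool (j \<in> J') = sum a J'"
          unfolding a'_def using sum_decrement[of J' a j] fin'(1) aj by simp
        moreover have "sum d' L' + of_bool (l \<in> L') = sum d L'"
          unfolding d'_def using sum_decrement[of L' d l] fin'(2) dl by simp
        moreover have "sum a J' \<le> sum b (J' \<times> (B - L')) + sum d L'"
          using cut sub unfolding cut_condition_def by blast
        ultimately show "sum a' J' \<le> sum b' (J' \<times> (B - L')) + sum d' L'"
          using sum_b'[OF sub(1), of L'] loose[OF sub]
          by (cases "j \<in> J'"; cases "l \<in> L'") auto
      qed
      from less.hyps[OF smaller this] obtain x where
        x: "\<forall>p\<in>A \<times> B. x p \<le> b' p" "\<forall>j\<in>A. (\<Sum>l\<in>B. x (j, l)) = a' j"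
           "\<forall>l\<in>B. (\<Sum>j\<in>A. x (j, l)) \<le> d' l" by blast
      define y where "y p = x p + of_bool (p = (j, l))" for p
      have "y p \<le> b p" if "p \<in> A \<times> B" for p
      proof -
        have "x p \<le> b' p" using x that by blast
        then show ?thesis using pos by (auto simp: y_def b'_def)
      qed
      moreover have "(\<Sum>l'\<in>B. y (j', l')) = a j'" if "j' \<in> A" for j'
      proof -
        have "(\<Sum>l'\<in>B. y (j', l')) = a' j' + (\<Sum>l'\<in>B. of_bool (j' = j \<and> l' = l))"
          using x(2) that by (simp add: y_def sum.distrib)
        also have "(\<Sum>l'\<in>B. of_bool (j' = j \<and> l' = l)) = (of_bool (j' = j) :: nat)"
          using fin jl by (cases "j' = j") (auto simp: of_bool_def)
        finally show ?thesis using aj by (auto simp: a'_def)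
      qed
      moreover have "(\<Sum>j'\<in>A. y (j', l')) \<le> d l'" if "l' \<in> B" for l'
      proof -
        have "(\<Sum>j'\<in>A. y (j', l')) \<le> d' l' + (\<Sum>j'\<in>A. of_bool (j' = j \<and> l' = l))"
          using x(3) that by (simp add: y_def sum.distrib)
        also have "(\<Sum>j'\<in>A. of_bool (j' = j \<and> l' = l)) = (of_bool (l' = l) :: nat)"
          using fin jl by (cases "l' = l") (auto simp: of_bool_def)
        finally show ?thesis using dl by (auto simp: d'_def split: if_splits)
      qed
      ultimately show ?thesis by blast
    qed
  qed
qed

lemma transportation:
  fixes b :: "'a \<times> 'b \<Rightarrow> nat" and a :: "'a \<Rightarrow> nat" and d :: "'b \<Rightarrow> nat"
  assumes fin: "finite A" "finite B" and cut: "cut_condition A B b a d"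
    and total: "sum a A = sum d B"
  obtains x where "\<forall>j\<in>A. \<forall>l\<in>B. x (j, l) \<le> b (j, l)"
    and "\<forall>j\<in>A. (\<Sum>l\<in>B. x (j, l)) = a j"
    and "\<forall>l\<in>B. (\<Sum>j\<in>A. x (j, l)) = d l"
proof -
  obtain x where x: "\<forall>p\<in>A \<times> B. x p \<le> b p" "\<forall>j\<in>A. (\<Sum>l\<in>B. x (j, l)) = a j"
    "\<forall>l\<in>B. (\<Sum>j\<in>A. x (j, l)) \<le> d l"
    using transportation_le[OF fin cut] by blast
  have "(\<Sum>l\<in>B. \<Sum>j\<in>A. x (j, l)) = sum d B"
    using x(2) total by (subst sum.swap) simp
  then have "(\<Sum>j\<in>A. x (j, l)) = d l" if "l \<in> B" for l
    using sum_mono_inv[of "\<lambda>l. \<Sum>j\<in>A. x (j, l)" B d l] x(3) that fin by auto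
  with x that[of x] show ?thesis by auto
qed

section \<open>Splitting a bipartite multigraph into parts of bounded degree\<close>

text \<open>
  The fractional factor \<open>x / m\<close> would do; the cut condition turns it into an integral one. Of the
  \<open>lam * m * card J\<close> edges at \<open>J\<close> at most \<open>lam * m * card L\<close> end in \<open>L\<close>, hence at least
  \<open>m * (lam * card J - lam * card L)\<close> end outside \<open>L\<close>, and \<open>m \<ge> 1\<close>.
\<close>

lemma regular_factor:
  fixes x :: "'a \<times> 'b \<Rightarrow> nat"
  assumes fin: "finite A" "finite B" and "0 < m"
    and rows: "\<And>j. j \<in> A \<Longrightarrow> (\<Sum>l\<in>B. x (j, l)) = lam * m"
    and cols: "\<And>l. l \<in> B \<Longrightarrow> (\<Sum>j\<in>A. x (j, l)) = lam * m"
  obtains z where "\<forall>j\<in>A. \<forall>l\<in>B. z (j, l) \<le> x (j, l)"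
    and "\<forall>j\<in>A. (\<Sum>l\<in>B. z (j, l)) = lam"
    and "\<forall>l\<in>B. (\<Sum>j\<in>A. z (j, l)) = lam"
proof -
  have "card A * (lam * m) = (\<Sum>j\<in>A. \<Sum>l\<in>B. x (j, l))" using rows by simp
  also have "\<dots> = card B * (lam * m)" using cols by (subst sum.swap) simp
  finally have total: "(\<Sum>j\<in>A. lam) = (\<Sum>l\<in>B. lam)" using \<open>0 < m\<close> by auto
  have cut: "cut_condition A B x (\<lambda>_. lam) (\<lambda>_. lam)"
    unfolding cut_condition_def
  proof (intro allI impI)
    fix J L assume sub: "J \<subseteq> A" "L \<subseteq> B"
    then have fin': "finite J" "finite L" using fin finite_subset by metis+
    have "card J * (lam * m) = (\<Sum>j\<in>J. \<Sum>l\<in>B. x (j, l))" using rows sub by (simp add: subset_iff)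
    also have "\<dots> = sum x (J \<times> B)" by (simp add: sum.cartesian_product)
    also have "\<dots> = sum x (J \<times> (B - L)) + sum x (J \<times> L)"
    proof -
      have "J \<times> B = J \<times> (B - L) \<union> J \<times> L" using sub by auto
      moreover have "J \<times> (B - L) \<inter> J \<times> L = {}" by auto
      ultimately show ?thesis using fin fin' by (simp only: sum.union_disjoint finite_SigmaI finite_Diff)
    qed
    also have "sum x (J \<times> L) \<le> sum x (A \<times> L)"
      using sub fin fin' by (intro sum_mono2) auto
    also have "sum x (A \<times> L) = (\<Sum>l\<in>L. \<Sum>j\<in>A. x (j, l))"
      by (subst sum.swap) (simp add: sum.cartesian_product)
    also have "\<dots> = card L * (lam * m)" using cols sub by (simp add: subset_iff)
    finally have *: "m * (card J * lam) \<le> sum x (J \<times> (B - L)) + m * (card L * lam)"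
      by (simp add: algebra_simps)
    have "card J * lam \<le> sum x (J \<times> (B - L)) + card L * lam"
    proof (cases "card J * lam \<le> card L * lam")
      case False
      then have "1 * (card J * lam - card L * lam) \<le> m * (card J * lam - card L * lam)"
        using \<open>0 < m\<close> by (intro mult_right_mono) auto
      also have "\<dots> \<le> sum x (J \<times> (B - L))"
        using * by (simp only: right_diff_distrib' le_diff_conv)
      finally show ?thesis by linarith
    qed linarith
    then show "(\<Sum>j\<in>J. lam) \<le> sum x (J \<times> (B - L)) + (\<Sum>l\<in>L. lam)" by simp
  qed
  show ?thesis
    by (rule transportation[OF fin cut total]) (rule that)
qed

text \<open>
  The parts are indexed by an arbitrary finite set \<open>I\<close>, so that the induction is on \<open>I\<close> and the
  parts can later be named by the rows that they fill.
\<close>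

lemma regular_splitting:
  fixes x :: "'a \<times> 'b \<Rightarrow> nat" and I :: "'i set"
  assumes "finite I" and fin: "finite A" "finite B"
    and "\<And>j. j \<in> A \<Longrightarrow> (\<Sum>l\<in>B. x (j, l)) = lam * card I"
    and "\<And>l. l \<in> B \<Longrightarrow> (\<Sum>j\<in>A. x (j, l)) = lam * card I"
  shows "\<exists>y. (\<forall>j\<in>A. \<forall>l\<in>B. (\<Sum>i\<in>I. y i (j, l)) = x (j, l)) \<and>
             (\<forall>i\<in>I. \<forall>j\<in>A. (\<Sum>l\<in>B. y i (j, l)) = lam) \<and>
             (\<forall>i\<in>I. \<forall>l\<in>B. (\<Sum>j\<in>A. y i (j, l)) = lam)"
  using assms(1,4,5)
proof (induction I arbitrary: x)
  case empty
  then show ?case using fin by auto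
next
  case (insert i0 I)
  have pos: "0 < card (insert i0 I)" using insert.hyps by simp
  obtain z where z: "\<forall>j\<in>A. \<forall>l\<in>B. z (j, l) \<le> x (j, l)"
    "\<forall>j\<in>A. (\<Sum>l\<in>B. z (j, l)) = lam" "\<forall>l\<in>B. (\<Sum>j\<in>A. z (j, l)) = lam"
    by (rule regular_factor[OF fin pos insert.prems]) (assumption | rule that)+
  have "(\<Sum>l\<in>B. x (j, l) - z (j, l)) = lam * card I" if "j \<in> A" for j
    using insert.prems(1)[OF that] z that insert.hyps by (simp add: sum_subtractf_nat)
  moreover have "(\<Sum>j\<in>A. x (j, l) - z (j, l)) = lam * card I" if "l \<in> B" for l
    using insert.prems(2)[OF that] z that insert.hyps by (simp add: sum_subtractf_nat)
  ultimately obtain y where y: "\<forall>j\<in>A. \<forall>l\<in>B. (\<Sum>i\<in>I. y i (j, l)) = x (j, l) - z (j, l)"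
    "\<forall>i\<in>I. \<forall>j\<in>A. (\<Sum>l\<in>B. y i (j, l)) = lam" "\<forall>i\<in>I. \<forall>l\<in>B. (\<Sum>j\<in>A. y i (j, l)) = lam"
    using insert.IH[of "\<lambda>p. x p - z p"] by blast
  have "(\<Sum>i\<in>insert i0 I. (y(i0 := z)) i (j, l)) = x (j, l)" if "j \<in> A" "l \<in> B" for j l
  proof -
    have "(\<Sum>i\<in>I. (y(i0 := z)) i (j, l)) = (\<Sum>i\<in>I. y i (j, l))"
      using insert.hyps by (intro sum.cong) auto
    then show ?thesis using insert.hyps y(1) z(1) that by simp
  qed
  then show ?case using y(2,3) z(2,3) by (intro exI[of _ "y(i0 := z)"]) auto
qed

text \<open>
  The vertices in \<open>A' - A\<close> are dummies that receive the missing degree \<open>defect l\<close> of each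
  \<open>l \<in> B\<close>. As \<open>card A' = card B\<close>, the missing degrees add up to what \<open>card (A' - A)\<close> vertices of
  degree \<open>lam * card I\<close> need. Forgetting the dummies in each part of a regular splitting keeps
  the degrees in \<open>A\<close> and can only lower those in \<open>B\<close>.
\<close>

lemma semiregular_splitting:
  fixes x :: "'a \<times> 'b \<Rightarrow> nat" and I :: "'i set"
  assumes "finite I" and fin: "finite A'" "finite B" and A: "A \<subseteq> A'" and card: "card A' = card B"
    and rows: "\<And>j. j \<in> A \<Longrightarrow> (\<Sum>l\<in>B. x (j, l)) = lam * card I"
    and cols: "\<And>l. l \<in> B \<Longrightarrow> (\<Sum>j\<in>A. x (j, l)) \<le> lam * card I"
  obtains y where "\<forall>j\<in>A. \<forall>l\<in>B. (\<Sum>i\<in>I. y i (j, l)) = x (j, l)"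
    and "\<forall>i\<in>I. \<forall>j\<in>A. (\<Sum>l\<in>B. y i (j, l)) = lam"
    and "\<forall>i\<in>I. \<forall>l\<in>B. (\<Sum>j\<in>A. y i (j, l)) \<le> lam"
proof -
  define D where "D = lam * card I"
  define defect where "defect l = D - (\<Sum>j\<in>A. x (j, l))" for l
  have finA: "finite A" using fin A finite_subset by metis
  have defect: "defect l + (\<Sum>j\<in>A. x (j, l)) = D" if "l \<in> B" for l
    using cols[OF that] by (simp add: defect_def D_def)
  have "sum defect B + (\<Sum>l\<in>B. \<Sum>j\<in>A. x (j, l)) = card B * D"
    using defect by (simp flip: sum.distrib)
  moreover have "(\<Sum>l\<in>B. \<Sum>j\<in>A. x (j, l)) = card A * D"
    using rows by (subst sum.swap) (simp add: D_def)
  moreover have "card A' = card A + card (A' - A)"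
    using card_Diff_subset[OF finA A] card_mono[OF fin(1) A] by simp
  ultimately have total: "sum (\<lambda>_. D) (A' - A) = sum defect B"
    using card by (simp add: algebra_simps)
  have cut: "cut_condition (A' - A) B (\<lambda>_. D) (\<lambda>_. D) defect"
    unfolding cut_condition_def
  proof (intro allI impI)
    fix J L assume sub: "J \<subseteq> A' - A" "L \<subseteq> B"
    show "(\<Sum>j\<in>J. D) \<le> (\<Sum>p\<in>J \<times> (B - L). D) + sum defect L"
    proof (cases "L = B")
      case True
      have "(\<Sum>j\<in>J. D) \<le> (\<Sum>j\<in>A' - A. D)" using sub fin by (intro sum_mono2) auto
      then show ?thesis unfolding True total by simp
    next
      case False
      then have "1 \<le> card (B - L)"
        using sub fin by (auto simp: Suc_le_eq card_gt_0_iff)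
      then have "card J * D * 1 \<le> card J * D * card (B - L)" by (rule mult_left_mono) simp
      then show ?thesis by (simp add: card_cartesian_product mult_ac trans_le_add1)
    qed
  qed
  obtain w where w: "\<forall>j\<in>A' - A. (\<Sum>l\<in>B. w (j, l)) = D"
    "\<forall>l\<in>B. (\<Sum>j\<in>A' - A. w (j, l)) = defect l"
    by (rule transportation[OF finite_Diff[OF fin(1)] fin(2) cut total]) (rule that)
  define u where "u p = (if fst p \<in> A then x p else w p)" for p
  have u_rows: "(\<Sum>l\<in>B. u (j, l)) = D" if "j \<in> A'" for j
    using that rows[of j] w(1) by (cases "j \<in> A") (simp_all add: u_def D_def)
  have u_cols: "(\<Sum>j\<in>A'. u (j, l)) = D" if "l \<in> B" for l
  proof -
    have "(\<Sum>j\<in>A'. u (j, l)) = (\<Sum>j\<in>A' - A. u (j, l)) + (\<Sum>j\<in>A. u (j, l))"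
      using A fin(1) by (rule sum.subset_diff)
    also have "\<dots> = (\<Sum>j\<in>A' - A. w (j, l)) + (\<Sum>j\<in>A. x (j, l))"
      by (simp add: u_def)
    finally show ?thesis using w(2) defect[OF that] that by simp
  qed
  obtain y where y: "\<forall>j\<in>A'. \<forall>l\<in>B. (\<Sum>i\<in>I. y i (j, l)) = u (j, l)"
    "\<forall>i\<in>I. \<forall>j\<in>A'. (\<Sum>l\<in>B. y i (j, l)) = lam" "\<forall>i\<in>I. \<forall>l\<in>B. (\<Sum>j\<in>A'. y i (j, l)) = lam"
    using regular_splitting[OF assms(1) fin, of u lam] u_rows u_cols unfolding D_def by blast
  show ?thesis
  proof (rule that[of y])
    show "\<forall>j\<in>A. \<forall>l\<in>B. (\<Sum>i\<in>I. y i (j, l)) = x (j, l)"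
      using y(1) A by (auto simp: u_def)
    show "\<forall>i\<in>I. \<forall>j\<in>A. (\<Sum>l\<in>B. y i (j, l)) = lam"
      using y(2) A by blast
    show "\<forall>i\<in>I. \<forall>l\<in>B. (\<Sum>j\<in>A. y i (j, l)) \<le> lam"
    proof (intro ballI)
      fix i l assume il: "i \<in> I" "l \<in> B"
      have "(\<Sum>j\<in>A. y i (j, l)) \<le> (\<Sum>j\<in>A'. y i (j, l))"
        using fin(1) A by (rule sum_mono2) simp
      then show "(\<Sum>j\<in>A. y i (j, l)) \<le> lam" using y(3) il by simp
    qed
  qed
qed

section \<open>Extending Latin rectangles\<close>

lemma sum_count_eq_size:
  assumes "finite B" "set_mset X \<subseteq> B"
  shows "(\<Sum>l\<in>B. count X l) = size X"
  unfolding size_multiset_overloaded_eq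
  using assms by (intro sum.mono_neutral_right) (auto simp: count_eq_zero_iff)

lemma mset_with_counts:
  fixes f :: "'a \<Rightarrow> nat"
  assumes "finite B"
  obtains X where "set_mset X \<subseteq> B" "\<And>l. l \<in> B \<Longrightarrow> count X l = f l" "size X = sum f B"
proof -
  define X where "X = (\<Sum>l\<in>B. replicate_mset (f l) l)"
  have cnt: "count X l = (if l \<in> B then f l else 0)" for l
    using assms by (simp add: X_def count_sum)
  have sub: "set_mset X \<subseteq> B"
    using cnt by (auto simp flip: count_greater_zero_iff split: if_splits)
  moreover have "size X = sum f B"
    using sum_count_eq_size[OF assms sub] cnt by simp
  ultimately show ?thesis using that[of X] cnt by simp
qed

lemma occ_eq_sum_col_occ: "occ r s M l = (\<Sum>j\<in>{1..s}. col_occ r M j l)"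
  unfolding occ_def col_occ_def by (rule sum.swap)

lemma col_occ_split:
  assumes "r \<le> n"
  shows "col_occ n N j l = col_occ r N j l + (\<Sum>i\<in>{r+1..n}. count (N i j) l)"
  using assms sum.ub_add_nat[of 1 r "\<lambda>i. count (N i j) l" "n - r"] by (simp add: col_occ_def)

text \<open>
  In column \<open>j\<close>, the symbols of \<open>K\<close> occur at most \<open>lam * card K\<close> times in \<open>N\<close>, so the new rows hold
  at most \<open>lam * card K - col_occ_set r M j K\<close> of them; the rest of the \<open>lam * (n - r)\<close> new symbols lie
  outside \<open>K\<close>. Summing over the columns counts new occurrences of symbols outside \<open>K\<close>.
\<close>

lemma extension_necessary:
  assumes rn: "r \<le> n"
    and N: "latin_square n k \<rho> lam N" and ext: "extends_to r n M N"
  shows "l \<in> {1..k} \<Longrightarrow> \<rho> l - int (occ r n M l) \<le> int lam * (int n - int r)"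
    and "K \<subseteq> {1..k} \<Longrightarrow>
      (\<Sum>j\<in>{1..n}.
          monus (int lam * int n - int lam * int r + int (col_occ_set r M j K))
                (int lam * int (card K)))
      \<le> (\<Sum>l\<in>{1..k} - K. \<rho> l - int (occ r n M l))"
proof -
  define x where "x j l = (\<Sum>i\<in>{r+1..n}. count (N i j) l)" for j l
  have colN: "col_occ n N j l = col_occ r M j l + x j l" if "j \<in> {1..n}" for j l
    using ext that unfolding col_occ_split[OF rn] by (simp add: col_occ_def x_def extends_to_def)
  have occ: "\<rho> l - int (occ r n M l) = int (\<Sum>j\<in>{1..n}. x j l)" if "l \<in> {1..k}" for l
  proof -
    have "\<rho> l = int (occ n n N l)" using N that by (simp add: latin_square_def)
    then show ?thesis using colN by (simp add: occ_eq_sum_col_occ sum.distrib)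
  qed
  show "\<rho> l - int (occ r n M l) \<le> int lam * (int n - int r)" if l: "l \<in> {1..k}" for l
  proof -
    have "(\<Sum>j\<in>{1..n}. x j l) = (\<Sum>i\<in>{r+1..n}. row_occ n N i l)"
      unfolding x_def row_occ_def by (rule sum.swap)
    also have "\<dots> \<le> (\<Sum>i\<in>{r+1..n}. lam)"
      using N l by (intro sum_mono) (auto simp: latin_square_def)
    also have "\<dots> = lam * (n - r)" by simp
    finally have "int (\<Sum>j\<in>{1..n}. x j l) \<le> int (lam * (n - r))" by (simp only: of_nat_le_iff)
    then show ?thesis using occ[OF l] rn by (simp add: of_nat_diff)
  qed
  show "(\<Sum>j\<in>{1..n}.
          monus (int lam * int n - int lam * int r + int (col_occ_set r M j K))
                (int lam * int (card K)))
      \<le> (\<Sum>l\<in>{1..k} - K. \<rho> l - int (occ r n M l))" if K: "K \<subseteq> {1..k}" for K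
  proof -
    have "(\<Sum>j\<in>{1..n}.
          monus (int lam * int n - int lam * int r + int (col_occ_set r M j K))
                (int lam * int (card K)))
      \<le> (\<Sum>j\<in>{1..n}. int (\<Sum>l\<in>{1..k} - K. x j l))"
    proof (rule sum_mono)
      fix j assume j: "j \<in> {1..n}"
      have "(\<Sum>l\<in>{1..k}. x j l) = (\<Sum>i\<in>{r+1..n}. \<Sum>l\<in>{1..k}. count (N i j) l)"
        unfolding x_def by (rule sum.swap)
      also have "\<dots> = (\<Sum>i\<in>{r+1..n}. lam)"
      proof (rule sum.cong)
        fix i assume "i \<in> {r+1..n}"
        then have "size (N i j) = lam" "set_mset (N i j) \<subseteq> {1..k}"
          using N j by (auto simp: latin_square_def lambda_matrix_def)
        then show "(\<Sum>l\<in>{1..k}. count (N i j) l) = lam"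
          using sum_count_eq_size[of "{1..k}" "N i j"] by simp
      qed simp
      also have "\<dots> = lam * (n - r)" by simp
      also have "(\<Sum>l\<in>{1..k}. x j l) = (\<Sum>l\<in>{1..k} - K. x j l) + (\<Sum>l\<in>K. x j l)"
        using K by (intro sum.subset_diff) auto
      finally have 1: "(\<Sum>l\<in>{1..k} - K. x j l) + (\<Sum>l\<in>K. x j l) = lam * (n - r)" .
      have "col_occ_set r M j K + (\<Sum>l\<in>K. x j l) = (\<Sum>l\<in>K. col_occ n N j l)"
        using colN[OF j] by (simp add: col_occ_set_def sum.distrib)
      also have "\<dots> \<le> (\<Sum>l\<in>K. lam)"
        using N j K by (intro sum_mono) (auto simp: latin_square_def)
      finally have 2: "col_occ_set r M j K + (\<Sum>l\<in>K. x j l) \<le> lam * card K"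
        by (simp add: mult.commute)
      have "int lam * int n - int lam * int r = int (lam * (n - r))"
        using rn by (simp add: of_nat_diff right_diff_distrib)
      also have "\<dots> = int (\<Sum>l\<in>{1..k} - K. x j l) + int (\<Sum>l\<in>K. x j l)"
        using 1 by (simp only: flip: of_nat_add)
      moreover have "int (col_occ_set r M j K) + int (\<Sum>l\<in>K. x j l) \<le> int lam * int (card K)"
        using 2 by (simp only: of_nat_le_iff flip: of_nat_add of_nat_mult)
      ultimately show "monus (int lam * int n - int lam * int r + int (col_occ_set r M j K))
          (int lam * int (card K)) \<le> int (\<Sum>l\<in>{1..k} - K. x j l)"
        unfolding monus_def by linarith
    qed
    also have "\<dots> = (\<Sum>l\<in>{1..k} - K. int (\<Sum>j\<in>{1..n}. x j l))"
      unfolding of_nat_sum by (rule sum.swap)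
    also have "\<dots> = (\<Sum>l\<in>{1..k} - K. \<rho> l - int (occ r n M l))"
      using occ by (intro sum.cong) auto
    finally show ?thesis .
  qed
qed

text \<open>
  Read \<open>x\<close> as a bipartite multigraph between columns and symbols. A part of its splitting, of degree
  \<open>lam\<close> at the columns and at most \<open>lam\<close> at the symbols, is a new row: cell \<open>j\<close> consists of the
  edges at column \<open>j\<close>. The hypothesis \<open>n \<le> k\<close> leaves room for \<open>k - n\<close> dummy columns.
\<close>

lemma extension_from_column_counts:
  assumes rn: "r \<le> n" and nk: "n \<le> k" and M: "latin_rectangle r n k \<rho> lam M"
    and cap: "\<And>j l. j \<in> {1..n} \<Longrightarrow> l \<in> {1..k} \<Longrightarrow> x (j, l) + col_occ r M j l \<le> lam"
    and rows: "\<And>j. j \<in> {1..n} \<Longrightarrow> (\<Sum>l\<in>{1..k}. x (j, l)) = lam * (n - r)"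
    and cols: "\<And>l. l \<in> {1..k} \<Longrightarrow> int (\<Sum>j\<in>{1..n}. x (j, l)) = \<rho> l - int (occ r n M l)"
    and bound: "\<And>l. l \<in> {1..k} \<Longrightarrow> (\<Sum>j\<in>{1..n}. x (j, l)) \<le> lam * (n - r)"
  shows "\<exists>N. latin_square n k \<rho> lam N \<and> extends_to r n M N"
proof -
  have sub: "{1..n} \<subseteq> {1..k}" using nk by simp
  have rows': "(\<Sum>l\<in>{1..k}. x (j, l)) = lam * card {r+1..n}" if "j \<in> {1..n}" for j
    using rows[OF that] by simp
  have bound': "(\<Sum>j\<in>{1..n}. x (j, l)) \<le> lam * card {r+1..n}" if "l \<in> {1..k}" for l
    using bound[OF that] by simp
  obtain y where
    y: "\<forall>j\<in>{1..n}. \<forall>l\<in>{1..k}. (\<Sum>i\<in>{r+1..n}. y i (j, l)) = x (j, l)"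
       "\<forall>i\<in>{r+1..n}. \<forall>j\<in>{1..n}. (\<Sum>l\<in>{1..k}. y i (j, l)) = lam"
       "\<forall>i\<in>{r+1..n}. \<forall>l\<in>{1..k}. (\<Sum>j\<in>{1..n}. y i (j, l)) \<le> lam"
    by (rule semiregular_splitting[OF finite_atLeastAtMost finite_atLeastAtMost
          finite_atLeastAtMost sub refl rows' bound']) (assumption | rule that)+
  have "\<exists>X. set_mset X \<subseteq> {1..k} \<and> (\<forall>l\<in>{1..k}. count X l = y i (j, l)) \<and>
          size X = (\<Sum>l\<in>{1..k}. y i (j, l))" for i j
    using mset_with_counts[of "{1..k}" "\<lambda>l. y i (j, l)"] by (metis finite_atLeastAtMost)
  then obtain Y where
    Y: "\<And>i j. set_mset (Y i j) \<subseteq> {1..k}" "\<And>i j l. l \<in> {1..k} \<Longrightarrow> count (Y i j) l = y i (j, l)"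
       "\<And>i j. size (Y i j) = (\<Sum>l\<in>{1..k}. y i (j, l))"
    by metis
  define N where "N i j = (if i \<le> r then M i j else Y i j)" for i j
  have colN: "col_occ n N j l = col_occ r M j l + x (j, l)" if "j \<in> {1..n}" "l \<in> {1..k}" for j l
  proof -
    have "col_occ r N j l = col_occ r M j l"
      by (simp add: N_def col_occ_def)
    moreover have "(\<Sum>i\<in>{r+1..n}. count (N i j) l) = x (j, l)"
      using y(1) Y(2)[OF that(2)] that by (simp add: N_def)
    ultimately show ?thesis unfolding col_occ_split[OF rn] by simp
  qed
  have "lambda_matrix n n k lam N"
    using M Y y(2) by (auto simp: lambda_matrix_def latin_rectangle_def N_def)
  moreover have "int (occ n n N l) = \<rho> l" if "l \<in> {1..k}" for l
    using cols[OF that] colN that by (simp add: occ_eq_sum_col_occ sum.distrib)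
  moreover have "row_occ n N i l \<le> lam" if "l \<in> {1..k}" "i \<in> {1..n}" for i l
    using M y(3) Y(2) that
    by (cases "i \<le> r") (auto simp: row_occ_def N_def latin_rectangle_def)
  moreover have "col_occ n N j l \<le> lam" if "l \<in> {1..k}" "j \<in> {1..n}" for j l
    using cap[of j l] colN that by (simp add: add.commute)
  moreover have "extends_to r n M N"
    by (simp add: extends_to_def N_def)
  ultimately show ?thesis unfolding latin_square_def by blast
qed

lemma sum_occ_rectangle:
  assumes "lambda_matrix r n k lam M"
  shows "(\<Sum>l\<in>{1..k}. occ r n M l) = lam * r * n"
proof -
  have "(\<Sum>l\<in>{1..k}. occ r n M l) = (\<Sum>i\<in>{1..r}. \<Sum>l\<in>{1..k}. \<Sum>j\<in>{1..n}. count (M i j) l)"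
    unfolding occ_def by (rule sum.swap)
  also have "\<dots> = (\<Sum>i\<in>{1..r}. \<Sum>j\<in>{1..n}. \<Sum>l\<in>{1..k}. count (M i j) l)"
    by (rule sum.cong[OF refl]) (rule sum.swap)
  also have "\<dots> = (\<Sum>i\<in>{1..r}. \<Sum>j\<in>{1..n}. lam)"
    using assms by (intro sum.cong refl) (simp add: lambda_matrix_def sum_count_eq_size)
  finally show ?thesis by (simp add: mult_ac)
qed

text \<open>
  The hypothesis \<open>hall\<close> for \<open>K\<close> contains, for every set \<open>J\<close> of columns, the cut condition for
  \<open>J\<close> and the complement of \<open>K\<close>: dropping the truncation and the columns outside
  \<open>J\<close> lowers the left-hand side.
\<close>

lemma extension_sufficient:
  assumes rn: "r \<le> n" and nk: "n \<le> k"
    and total: "(\<Sum>l\<in>{1..k}. \<rho> l) = int lam * (int n)^2"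
    and M: "latin_rectangle r n k \<rho> lam M"
    and few: "\<forall>l\<in>{1..k}. \<rho> l - int (occ r n M l) \<le> int lam * (int n - int r)"
    and hall: "\<forall>K. K \<subseteq> {1..k} \<longrightarrow>
      (\<Sum>j\<in>{1..n}.
          monus (int lam * int n - int lam * int r + int (col_occ_set r M j K))
                (int lam * int (card K)))
      \<le> (\<Sum>l\<in>{1..k} - K. \<rho> l - int (occ r n M l))"
  shows "\<exists>N. latin_square n k \<rho> lam N \<and> extends_to r n M N"
proof -
  define b where "b = (\<lambda>(j, l). lam - col_occ r M j l)"
  define d where "d l = nat (\<rho> l - int (occ r n M l))" for l
  have b: "int (b (j, l)) = int lam - int (col_occ r M j l)"
    if "j \<in> {1..n}" "l \<in> {1..k}" for j l
    using M that by (simp add: b_def latin_rectangle_def of_nat_diff)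
  have d: "int (d l) = \<rho> l - int (occ r n M l)" if "l \<in> {1..k}" for l
    using M that by (simp add: d_def latin_rectangle_def)
  have new_rows: "int (lam * (n - r)) = int lam * int n - int lam * int r"
    using rn by (simp add: of_nat_diff right_diff_distrib)
  have "int (sum d {1..k}) = (\<Sum>l\<in>{1..k}. \<rho> l) - int (\<Sum>l\<in>{1..k}. occ r n M l)"
    using d by (simp add: sum_subtractf)
  also have "\<dots> = int lam * (int n)^2 - int (lam * r * n)"
    using total sum_occ_rectangle[of r n k lam M] M by (simp add: latin_rectangle_def)
  also have "\<dots> = int n * int (lam * (n - r))"
    unfolding new_rows by (simp add: power2_eq_square algebra_simps)
  finally have "sum d {1..k} = n * (lam * (n - r))"
    by (simp only: of_nat_eq_iff flip: of_nat_mult)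
  then have sum_d: "(\<Sum>j\<in>{1..n}. lam * (n - r)) = sum d {1..k}"
    by simp
  have cut: "cut_condition {1..n} {1..k} b (\<lambda>_. lam * (n - r)) d"
    unfolding cut_condition_def
  proof (intro allI impI)
    fix J L assume sub: "J \<subseteq> {1..n}" "L \<subseteq> {1..k}"
    define K where "K = {1..k} - L"
    let ?t = "\<lambda>j. int lam * int n - int lam * int r + int (col_occ_set r M j K)"
    let ?c = "int lam * int (card K)"
    have K: "K \<subseteq> {1..k}" "{1..k} - K = L" using sub by (auto simp: K_def)
    have "int (\<Sum>l\<in>K. b (j, l)) = ?c - int (col_occ_set r M j K)" if "j \<in> J" for j
    proof -
      have "int (\<Sum>l\<in>K. b (j, l)) = (\<Sum>l\<in>K. int lam - int (col_occ r M j l))"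
        unfolding of_nat_sum
      proof (rule sum.cong[OF refl])
        fix l assume "l \<in> K"
        then show "int (b (j, l)) = int lam - int (col_occ r M j l)"
          by (intro b subsetD[OF sub(1) that] subsetD[OF K(1)])
      qed
      then show ?thesis by (simp add: col_occ_set_def sum_subtractf)
    qed
    then have "(\<Sum>j\<in>J. int (lam * (n - r)) - int (\<Sum>l\<in>K. b (j, l))) = (\<Sum>j\<in>J. ?t j - ?c)"
      unfolding new_rows by (intro sum.cong) auto
    also have "\<dots> \<le> (\<Sum>j\<in>J. monus (?t j) ?c)"
      by (intro sum_mono) (simp add: monus_def)
    also have "\<dots> \<le> (\<Sum>j\<in>{1..n}. monus (?t j) ?c)"
      using sub by (intro sum_mono2) (auto simp: monus_def)
    also have "\<dots> \<le> (\<Sum>l\<in>L. \<rho> l - int (occ r n M l))"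
      using hall[rule_format, OF K(1)] unfolding K(2) .
    also have "\<dots> = int (sum d L)"
      unfolding of_nat_sum by (rule sum.cong[OF refl], rule d[symmetric]) (rule subsetD[OF sub(2)])
    finally have "int (\<Sum>j\<in>J. lam * (n - r)) \<le> int (\<Sum>j\<in>J. \<Sum>l\<in>K. b (j, l)) + int (sum d L)"
      unfolding sum_subtractf of_nat_sum by linarith
    then have "(\<Sum>j\<in>J. lam * (n - r)) \<le> (\<Sum>j\<in>J. \<Sum>l\<in>K. b (j, l)) + sum d L"
      by (simp only: of_nat_le_iff flip: of_nat_add)
    then show "(\<Sum>j\<in>J. lam * (n - r)) \<le> sum b (J \<times> ({1..k} - L)) + sum d L"
      by (simp add: K_def sum.cartesian_product)
  qed
  obtain x where
    x: "\<forall>j\<in>{1..n}. \<forall>l\<in>{1..k}. x (j, l) \<le> b (j, l)"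
       "\<forall>j\<in>{1..n}. (\<Sum>l\<in>{1..k}. x (j, l)) = lam * (n - r)"
       "\<forall>l\<in>{1..k}. (\<Sum>j\<in>{1..n}. x (j, l)) = d l"
    by (rule transportation[OF finite_atLeastAtMost finite_atLeastAtMost cut sum_d]) (rule that)
  show ?thesis
  proof (rule extension_from_column_counts[OF rn nk M, of x])
    show "x (j, l) + col_occ r M j l \<le> lam" if "j \<in> {1..n}" "l \<in> {1..k}" for j l
      using bspec[OF bspec[OF x(1) that(1)] that(2)] b[OF that] by linarith
    show "(\<Sum>l\<in>{1..k}. x (j, l)) = lam * (n - r)" if "j \<in> {1..n}" for j
      using x(2) that by blast
    show "int (\<Sum>j\<in>{1..n}. x (j, l)) = \<rho> l - int (occ r n M l)" if "l \<in> {1..k}" for l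
      using x(3) d[OF that] that by simp
    show "(\<Sum>j\<in>{1..n}. x (j, l)) \<le> lam * (n - r)" if "l \<in> {1..k}" for l
    proof -
      have "int (d l) \<le> int (lam * (n - r))"
        using few that d[OF that] unfolding new_rows by (simp add: right_diff_distrib)
      then show ?thesis using x(3) that by (simp only: of_nat_le_iff)
    qed
  qed
qed

theorem corollary4p5:
  fixes r n k lam :: nat and \<rho> :: "nat \<Rightarrow> int" and M :: array
  assumes "0 < n" and "0 < k" and "0 < lam"
    and "r \<le> n" and "n \<le> k"
    and "\<forall>l\<in>{1..k}. 1 \<le> \<rho> l \<and> \<rho> l \<le> int lam * int n"
    and "(\<Sum>l\<in>{1..k}. \<rho> l) = int lam * (int n)^2"
    and "latin_rectangle r n k \<rho> lam M"
  shows "(\<exists>N. latin_square n k \<rho> lam N \<and> extends_to r n M N) \<longleftrightarrow>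
    (\<forall>l\<in>{1..k}. \<rho> l - int (occ r n M l) \<le> int lam * (int n - int r)) \<and>
    (\<forall>K. K \<subseteq> {1..k} \<longrightarrow>
      (\<Sum>j\<in>{1..n}.
          monus (int lam * int n - int lam * int r + int (col_occ_set r M j K))
                (int lam * int (card K)))
      \<le> (\<Sum>l\<in>{1..k} - K. \<rho> l - int (occ r n M l)))"
  using extension_necessary[OF \<open>r \<le> n\<close>] extension_sufficient[OF assms(4,5,7,8)] by blast

end
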